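(* Let $I=[a,b]$ with $a<b<\infty$, or $I=[a,b)$ with $a<b\le\infty$ ($a\in\mathbb R$), and let $m\in\mathbb N$. Assume that the mappings $f_i:L^1(I)^m\to\mathcal A_L(I)$, $i=1,\dots,m$, are increasing, and that the integrals $F_i(x)(t)=\int_a^tf_i(x)$, $t\in I$, satisfy $\|F_i(x)\|_1\le Q(\|x\|)$ for all $x\in L^1(I)^m$ and $i=1,\dots,m$, where $Q:\mathbb R_+\to\mathbb R_+$ is increasing, $R=Q(R)$ for some $R>0$, and $r\le Q(r)$ implies $r\le R$. Then the Cauchy system $$y_i'=f_i(y_1,\dots,y_m),\quad y_i(a)=0,\quad i=1,\dots,m,$$ has minimal and maximal solutions in $\mathcal L^{lc}(I)^m$.
   Context: $\mathcal D'$ is the space of distributions on $I$: continuous linear functionals on the space $\mathcal D$ of infinitely differentiable functions $\varphi:\mathbb R\to\mathbb R$ whose support is a compact subset of $I$, with $\varphi_n\to\varphi$ in $\mathcal D$ if all supports lie in one compact $K\subseteq I$ and all derivatives converge uniformly on $K$. The derivative is $\langle T',\varphi\rangle=-\langle T,\varphi'\rangle$; integrable functions $H$ are identified with $\varphi\mapsto\int_IH\varphi\,dt$. $L^1(I)$ is the space of (classes of) Lebesgue integrable functions on $I$, ordered a.e. pointwise, with norm $\|x\|_1=\int_I|x(s)|\,ds$; $L^1(I)^m$ is ordered componentwise and normed by $\|x\|=\max\{\|x_i\|_1:i=1,\dots,m\}$. $\mathcal L^{lc}(I)$ is the space of functions $I\to\mathbb R$ that are Lebesgue integrable on $I$, left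 continuous at every point of $I$ other than $a$, and right continuous at $a$; it is ordered pointwise and $\mathcal L^{lc}(I)^m$ componentwise. $\mathcal L^{lc}_0(I)=\{F\in\mathcal L^{lc}(I):F(a)=0\}$. $\mathcal A_L(I)$ is the set of distributions $f$ with $f=F'$ for some (necessarily unique) $F\in\mathcal L^{lc}_0(I)$; then $\int_a^tf:=F(t)$. It is ordered by $f\preceq g$ iff $\int_a^tf\le\int_a^tg$ for all $t\in I$. Increasing means: $x\le y$ implies $f_i(x)\preceq f_i(y)$. A solution of the system in $\mathcal L^{lc}(I)^m$ is $(y_1,\dots,y_m)\in\mathcal L^{lc}(I)^m$ with distributional derivatives $y_i'=f_i(y_1,\dots,y_m)$ and $y_i(a)=0$ for all $i$; minimal (maximal) means minimal (maximal) in the set of all solutions in $\mathcal L^{lc}(I)^m$. *)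

theory Defs
  imports "HOL-Analysis.Analysis"
begin

text \<open>
  Functions on \<open>I\<close> that are considered pointwise, and functionals on the test space, are
  represented by their extensional representatives (from \<^theory>\<open>HOL-Library.FuncSet\<close>), so
  that HOL equality is equality of functions on \<open>I\<close>, respectively of distributions.
\<close>

section \<open>Distributions on an interval\<close>

definition supp :: "(real \<Rightarrow> real) \<Rightarrow> real set" where
  "supp \<phi> = closure {t. \<phi> t \<noteq> 0}"

definition test_functions :: "real set \<Rightarrow> (real \<Rightarrow> real) set" where
  "test_functions I = {\<phi>. (\<forall>k t. ((deriv ^^ k) \<phi>) differentiable (at t)) \<and> compact (supp \<phi>) \<and> supp \<phi> \<subseteq> I}"

text \<open>
  The limit \<open>\<psi>\<close> is also required to be supported in \<open>K\<close>: uniform convergence on \<open>K\<close> alone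
  would not control \<open>\<psi>\<close> outside \<open>K\<close>.
\<close>

definition test_converges :: "real set \<Rightarrow> (nat \<Rightarrow> real \<Rightarrow> real) \<Rightarrow> (real \<Rightarrow> real) \<Rightarrow> bool" where
  "test_converges I \<phi> \<psi> \<longleftrightarrow>
     (\<exists>K. compact K \<and> K \<subseteq> I \<and> (\<forall>n. supp (\<phi> n) \<subseteq> K) \<and> supp \<psi> \<subseteq> K \<and>
       (\<forall>k. uniform_limit K (\<lambda>n. (deriv ^^ k) (\<phi> n)) ((deriv ^^ k) \<psi>) sequentially))"

type_synonym dist = "(real \<Rightarrow> real) \<Rightarrow> real"

definition distributions :: "real set \<Rightarrow> dist set" where
  "distributions I = {T \<in> extensional (test_functions I).
     (\<forall>\<phi>\<in>test_functions I. \<forall>\<psi>\<in>test_functions I. T (\<lambda>t. \<phi> t + \<psi> t) = T \<phi> + T \<psi>) \<and>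
     (\<forall>c. \<forall>\<phi>\<in>test_functions I. T (\<lambda>t. c * \<phi> t) = c * T \<phi>) \<and>
     (\<forall>\<phi> \<psi>. (\<forall>n. \<phi> n \<in> test_functions I) \<longrightarrow> \<psi> \<in> test_functions I \<longrightarrow> test_converges I \<phi> \<psi> \<longrightarrow>
        (\<lambda>n. T (\<phi> n)) \<longlonglongrightarrow> T \<psi>)}"

definition dist_deriv :: "real set \<Rightarrow> dist \<Rightarrow> dist" where
  "dist_deriv I T = (\<lambda>\<phi>\<in>test_functions I. - T (deriv \<phi>))"

definition dist_of :: "real set \<Rightarrow> (real \<Rightarrow> real) \<Rightarrow> dist" where
  "dist_of I H = (\<lambda>\<phi>\<in>test_functions I. LINT t:I|lebesgue. H t * \<phi> t)"

section \<open>Classes of integrable functions\<close>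

definition L1_rel :: "real set \<Rightarrow> ((real \<Rightarrow> real) \<times> (real \<Rightarrow> real)) set" where
  "L1_rel I = {(x, y). x absolutely_integrable_on I \<and> y absolutely_integrable_on I \<and>
                       (AE s in lebesgue. s \<in> I \<longrightarrow> x s = y s)}"

definition L1 :: "real set \<Rightarrow> (real \<Rightarrow> real) set set" where
  "L1 I = {x. x absolutely_integrable_on I} // L1_rel I"

definition L1_class :: "real set \<Rightarrow> (real \<Rightarrow> real) \<Rightarrow> (real \<Rightarrow> real) set" where
  "L1_class I x = L1_rel I `` {x}"

definition L1_le :: "real set \<Rightarrow> (real \<Rightarrow> real) set \<Rightarrow> (real \<Rightarrow> real) set \<Rightarrow> bool" where
  "L1_le I X Y \<longleftrightarrow> (\<forall>x\<in>X. \<forall>y\<in>Y. AE s in lebesgue. s \<in> I \<longrightarrow> x s \<le> y s)"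

text \<open>The norm does not depend on the chosen representative; see \<open>L1_norm_class\<close> below.\<close>

definition L1_norm :: "real set \<Rightarrow> (real \<Rightarrow> real) set \<Rightarrow> real" where
  "L1_norm I X = (LINT s:I|lebesgue. \<bar>(SOME x. x \<in> X) s\<bar>)"

lemma equiv_L1_rel: "equiv {x. x absolutely_integrable_on I} (L1_rel I)"
proof (rule equivI)
  show "L1_rel I \<subseteq> {x. x absolutely_integrable_on I} \<times> {x. x absolutely_integrable_on I}"
    by (auto simp: L1_rel_def)
  show "refl_on {x. x absolutely_integrable_on I} (L1_rel I)"
    by (auto simp: refl_on_def L1_rel_def)
  show "sym (L1_rel I)"
    by (auto simp: sym_def L1_rel_def elim: eventually_mono)
  show "trans (L1_rel I)"
  proof (rule transI)
    fix x y z assume xy: "(x, y) \<in> L1_rel I" and yz: "(y, z) \<in> L1_rel I"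
    have "AE s in lebesgue. s \<in> I \<longrightarrow> x s = y s" "AE s in lebesgue. s \<in> I \<longrightarrow> y s = z s"
      using xy yz by (simp_all add: L1_rel_def)
    then have "AE s in lebesgue. s \<in> I \<longrightarrow> x s = z s"
      by eventually_elim simp
    then show "(x, z) \<in> L1_rel I"
      using xy yz by (simp add: L1_rel_def)
  qed
qed

lemma L1_norm_class:
  assumes x: "x absolutely_integrable_on I"
  shows "L1_norm I (L1_class I x) = (LINT s:I|lebesgue. \<bar>x s\<bar>)"
proof -
  let ?z = "SOME z. z \<in> L1_class I x"
  have "x \<in> L1_class I x"
    using x by (simp add: L1_class_def L1_rel_def)
  then have "?z \<in> L1_class I x"
    by (rule someI[where P = "\<lambda>z. z \<in> L1_class I x"])
  then have z: "?z absolutely_integrable_on I" and ae: "AE s in lebesgue. s \<in> I \<longrightarrow> x s = ?z s"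
    by (auto simp: L1_class_def L1_rel_def)
  have abs: "(\<lambda>s. indicator I s *\<^sub>R \<bar>y s\<bar>) \<in> borel_measurable lebesgue"
    if "y absolutely_integrable_on I" for y :: "real \<Rightarrow> real"
    using set_integrable_abs[OF that] unfolding set_integrable_def
    by (rule borel_measurable_integrable)
  show ?thesis
    unfolding L1_norm_def set_lebesgue_integral_def
  proof (rule integral_cong_AE)
    show "AE s in lebesgue. indicator I s *\<^sub>R \<bar>?z s\<bar> = indicator I s *\<^sub>R \<bar>x s\<bar>"
      using ae by eventually_elim (auto simp: indicator_def)
  qed (use abs[OF x] abs[OF z] in auto)
qed

text \<open>
  \<open>m\<close>-tuples are functions on a finite index type \<open>'m\<close>, with \<open>m = CARD('m) \<ge> 1\<close>.
\<close>

definition L1_pow :: "real set \<Rightarrow> ('m::finite \<Rightarrow> (real \<Rightarrow> real) set) set" where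
  "L1_pow I = {x. \<forall>i. x i \<in> L1 I}"

definition L1_pow_le ::
  "real set \<Rightarrow> ('m::finite \<Rightarrow> (real \<Rightarrow> real) set) \<Rightarrow> ('m \<Rightarrow> (real \<Rightarrow> real) set) \<Rightarrow> bool" where
  "L1_pow_le I x y \<longleftrightarrow> (\<forall>i. L1_le I (x i) (y i))"

definition L1_pow_norm :: "real set \<Rightarrow> ('m::finite \<Rightarrow> (real \<Rightarrow> real) set) \<Rightarrow> real" where
  "L1_pow_norm I x = Max (range (\<lambda>i. L1_norm I (x i)))"

section \<open>Left continuous primitives\<close>

definition Llc :: "real \<Rightarrow> real set \<Rightarrow> (real \<Rightarrow> real) set" where
  "Llc a I = {F \<in> extensional I. F absolutely_integrable_on I \<and>
     (\<forall>t\<in>I. t \<noteq> a \<longrightarrow> continuous (at_left t) F) \<and> continuous (at_right a) F}"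

definition Llc0 :: "real \<Rightarrow> real set \<Rightarrow> (real \<Rightarrow> real) set" where
  "Llc0 a I = {F \<in> Llc a I. F a = 0}"

definition Llc_pow_le ::
  "real set \<Rightarrow> ('m::finite \<Rightarrow> real \<Rightarrow> real) \<Rightarrow> ('m \<Rightarrow> real \<Rightarrow> real) \<Rightarrow> bool" where
  "Llc_pow_le I y z \<longleftrightarrow> (\<forall>i. \<forall>t\<in>I. y i t \<le> z i t)"

definition AL :: "real \<Rightarrow> real set \<Rightarrow> dist set" where
  "AL a I = {f \<in> distributions I. \<exists>F\<in>Llc0 a I. f = dist_deriv I (dist_of I F)}"

definition primitive :: "real \<Rightarrow> real set \<Rightarrow> dist \<Rightarrow> real \<Rightarrow> real" where
  "primitive a I f = (THE F. F \<in> Llc0 a I \<and> f = dist_deriv I (dist_of I F))"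

definition AL_le :: "real \<Rightarrow> real set \<Rightarrow> dist \<Rightarrow> dist \<Rightarrow> bool" where
  "AL_le a I f g \<longleftrightarrow> (\<forall>t\<in>I. primitive a I f t \<le> primitive a I g t)"

section \<open>The Cauchy system\<close>

definition solutions ::
  "real \<Rightarrow> real set \<Rightarrow> ('m::finite \<Rightarrow> ('m \<Rightarrow> (real \<Rightarrow> real) set) \<Rightarrow> dist) \<Rightarrow> ('m \<Rightarrow> real \<Rightarrow> real) set" where
  "solutions a I f = {y. (\<forall>i. y i \<in> Llc a I) \<and>
     (\<forall>i. dist_deriv I (dist_of I (y i)) = f i (\<lambda>j. L1_class I (y j))) \<and> (\<forall>i. y i a = 0)}"

definition minimal_in :: "('a \<Rightarrow> 'a \<Rightarrow> bool) \<Rightarrow> 'a set \<Rightarrow> 'a \<Rightarrow> bool" where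
  "minimal_in le S y \<longleftrightarrow> y \<in> S \<and> (\<forall>z\<in>S. le z y \<longrightarrow> z = y)"

definition maximal_in :: "('a \<Rightarrow> 'a \<Rightarrow> bool) \<Rightarrow> 'a set \<Rightarrow> 'a \<Rightarrow> bool" where
  "maximal_in le S y \<longleftrightarrow> y \<in> S \<and> (\<forall>z\<in>S. le y z \<longrightarrow> z = y)"

end

theory Submission
  imports Defs
begin

text \<open>
  The distributions in \<open>AL a I\<close> correspond to their primitives in \<open>Llc0 a I\<close>, so the Cauchy system
  is a fixed point equation \<open>y = T y\<close> with \<open>T x i = primitive a I (f i [x])\<close>, where \<open>[x]\<close> is the tuple
  of classes of \<open>x\<close>. This rests on the uniqueness of primitives (\<open>same_derivative_eq\<close>): if two left
  continuous functions have the same distributional derivative, testing with smooth functions that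
  rise just to the left of \<open>s\<close> and fall just to the left of \<open>t\<close> shows that their difference has the
  same value at \<open>s\<close> and at \<open>t\<close>. The smooth functions are built from \<open>exp (- 1 / x)\<close>.

  The map \<open>T\<close> is increasing for the almost everywhere order. By the conditions on \<open>Q\<close> it maps the
  \<open>L\<^sup>1\<close> ball of radius \<open>R\<close> into itself, and every solution lies in that ball. It remains to find
  extremal fixed points of an increasing self-map of an \<open>L\<^sup>1\<close> ball. There, increasing sequences have
  suprema (Beppo Levi), and the sum of the integrals of the components is a bounded functional,
  strictly increasing up to almost everywhere equality. The ordering principle of Brezis and Browder
  therefore gives a maximal element in every nonempty subset of the ball that is closed under
  suprema of increasing sequences (\<open>ae_maximal_exists\<close>).

  This is used twice. A maximal \<open>x\<close> with \<open>x \<le> max 0 (T x)\<close> satisfies \<open>x = max 0 (T x) \<ge> T x\<close>; here the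
  centre \<open>0\<close> enters, since taking positive parts does not leave the ball. Replacing \<open>T\<close> by
  \<open>x \<mapsto> - T (- x)\<close> gives a point with \<open>x \<le> T x\<close>, so the set of all such points is nonempty, and a
  maximal one is a maximal fixed point. The same substitution turns maximal fixed points into
  minimal ones. Applying \<open>T\<close> to an almost everywhere fixed point yields a genuine solution, because
  \<open>T x\<close> depends only on the classes of \<open>x\<close>.
\<close>

section \<open>Smooth functions built from \<open>exp (- 1 / x)\<close>\<close>

definition flat :: "nat \<Rightarrow> real \<Rightarrow> real" where
  "flat n x = (if x > 0 then exp (- 1 / x) / x ^ n else 0)"

lemma flat_tendsto_0: "(flat n \<longlongrightarrow> 0) (at_right 0)"
proof (rule Lim_transform_eventually)
  show "((\<lambda>x. inverse x ^ n / exp (inverse x)) \<longlongrightarrow> (0::real)) (at_right 0)"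
    using filterlim_compose[OF tendsto_power_div_exp_0 filterlim_inverse_at_top_right] .
  show "\<forall>\<^sub>F x in at_right 0. inverse x ^ n / exp (inverse x) = flat n x"
    unfolding eventually_at_right_field
    by (intro exI[of _ 1]) (auto simp: flat_def exp_minus field_simps)
qed

lemma flat_has_derivative:
  "(flat n has_real_derivative (flat (n + 2) x - real n * flat (n + 1) x)) (at x)"
proof -
  consider "x > 0" | "x < 0" | "x = 0" by linarith
  then show ?thesis
  proof cases
    case 1
    have pow: "real n * x ^ (n - Suc 0) = real n * x ^ n / x"
      using 1 by (cases n) auto
    have "((\<lambda>x. exp (- 1 / x) / x ^ n) has_real_derivative (flat (n + 2) x - real n * flat (n + 1) x)) (at x)"
      using 1 pow by (auto intro!: derivative_eq_intros simp: flat_def divide_simps power2_eq_square algebra_simps)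
    then show ?thesis
      by (rule has_field_derivative_transform_within_open[where S = "{0<..}"]) (use 1 in \<open>auto simp: flat_def\<close>)
  next
    case 2
    have "((\<lambda>x. 0) has_real_derivative (flat (n + 2) x - real n * flat (n + 1) x)) (at x)"
      using 2 by (simp add: flat_def)
    then show ?thesis
      by (rule has_field_derivative_transform_within_open[where S = "{..<0}"]) (use 2 in \<open>auto simp: flat_def\<close>)
  next
    case 3
    have "((\<lambda>y. (flat n y - flat n 0) / (y - 0)) \<longlongrightarrow> 0) (at 0)"
    proof (rule filterlim_split_at)
      show "((\<lambda>y. (flat n y - flat n 0) / (y - 0)) \<longlongrightarrow> 0) (at_left 0)"
        by (rule Lim_transform_eventually[OF tendsto_const])
          (auto simp: flat_def eventually_at_left_field intro!: exI[of _ "-1"])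
      show "((\<lambda>y. (flat n y - flat n 0) / (y - 0)) \<longlongrightarrow> 0) (at_right 0)"
        by (rule Lim_transform_eventually[OF flat_tendsto_0[of "Suc n"]])
          (auto simp: flat_def eventually_at_right_field intro!: exI[of _ 1])
    qed
    then show ?thesis
      using 3 by (simp add: has_field_derivative_iff flat_def)
  qed
qed

text \<open>
  A set of functions that is closed under differentiation consists of smooth functions. Keeping the
  powers of \<open>1 / x\<close> as separate generators is what makes the derivative of a generator a
  combination of generators.
\<close>

inductive_set flat_algebra :: "(real \<Rightarrow> real) set" where
  flat: "flat n \<in> flat_algebra"
| const: "(\<lambda>_. c) \<in> flat_algebra"
| add: "\<lbrakk>p \<in> flat_algebra; q \<in> flat_algebra\<rbrakk> \<Longrightarrow> (\<lambda>x. p x + q x) \<in> flat_algebra"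
| mult: "\<lbrakk>p \<in> flat_algebra; q \<in> flat_algebra\<rbrakk> \<Longrightarrow> (\<lambda>x. p x * q x) \<in> flat_algebra"
| affine: "p \<in> flat_algebra \<Longrightarrow> (\<lambda>x. p (c * x + d)) \<in> flat_algebra"

lemma flat_algebra_scale: "p \<in> flat_algebra \<Longrightarrow> (\<lambda>x. c * p x) \<in> flat_algebra"
  by (intro flat_algebra.mult flat_algebra.const)

lemma flat_algebra_has_derivative:
  assumes "p \<in> flat_algebra"
  shows "\<exists>q\<in>flat_algebra. \<forall>x. (p has_real_derivative q x) (at x)"
  using assms
proof induction
  case (flat n)
  show ?case
    by (intro bexI[of _ "\<lambda>x. flat (n + 2) x + (- real n) * flat (n + 1) x"] allI
        flat_algebra.add flat_algebra_scale flat_algebra.flat)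
      (use flat_has_derivative[of n] in simp)
next
  case (const c)
  show ?case
    by (intro bexI[of _ "\<lambda>x. 0"]) (auto intro: flat_algebra.const)
next
  case (add p q)
  then obtain p' q' where
    "p' \<in> flat_algebra" "\<forall>x. (p has_real_derivative p' x) (at x)"
    "q' \<in> flat_algebra" "\<forall>x. (q has_real_derivative q' x) (at x)" by blast
  then show ?case
    by (intro bexI[of _ "\<lambda>x. p' x + q' x"]) (auto intro: DERIV_add flat_algebra.add)
next
  case (mult p q)
  then obtain p' q' where
    "p' \<in> flat_algebra" "\<forall>x. (p has_real_derivative p' x) (at x)"
    "q' \<in> flat_algebra" "\<forall>x. (q has_real_derivative q' x) (at x)" by blast
  with mult.hyps show ?case
    by (intro bexI[of _ "\<lambda>x. p' x * q x + q' x * p x"])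
      (auto intro: DERIV_mult flat_algebra.add flat_algebra.mult)
next
  case (affine p c d)
  then obtain p' where p': "p' \<in> flat_algebra" "\<forall>x. (p has_real_derivative p' x) (at x)" by blast
  have "((\<lambda>x. p (c * x + d)) has_real_derivative p' (c * x + d) * c) (at x)" for x
    by (rule DERIV_chain2[where f = p]) (use p' in \<open>auto intro!: derivative_eq_intros\<close>)
  with p' show ?case
    by (intro bexI[of _ "\<lambda>x. p' (c * x + d) * c"])
      (auto intro: flat_algebra.mult flat_algebra.affine flat_algebra.const)
qed

lemma flat_algebra_smooth:
  assumes "p \<in> flat_algebra"
  shows "((deriv ^^ k) p) differentiable (at t)"
proof -
  have "(deriv ^^ k) p \<in> flat_algebra"
  proof (induction k)
    case (Suc k)
    then obtain q where "q \<in> flat_algebra" "\<forall>x. ((deriv ^^ k) p has_real_derivative q x) (at x)"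
      using flat_algebra_has_derivative by blast
    moreover from this have "(deriv ^^ Suc k) p = q"
      by (auto intro!: DERIV_imp_deriv)
    ultimately show ?case by simp
  qed (use assms in simp)
  then show ?thesis
    using flat_algebra_has_derivative real_differentiable_def by blast
qed

text \<open>
  Primitives of members need not belong to the algebra, but only their first derivative has to.
\<close>

lemma antiderivative_smooth:
  assumes p: "p \<in> flat_algebra" and \<phi>: "\<And>x. (\<phi> has_real_derivative p x) (at x)"
  shows "((deriv ^^ k) \<phi>) differentiable (at t)"
proof (cases k)
  case 0
  then show ?thesis using \<phi> real_differentiable_def by auto
next
  case (Suc j)
  have "deriv \<phi> = p" using \<phi> by (auto intro!: DERIV_imp_deriv)
  then have "(deriv ^^ k) \<phi> = (deriv ^^ j) p" by (simp add: Suc funpow_Suc_right del: funpow.simps)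
  then show ?thesis using flat_algebra_smooth[OF p] by simp
qed

definition bump :: "real \<Rightarrow> real" where
  "bump x = flat 0 x * flat 0 (1 - x)"

lemma bump_eq_0: "x \<le> 0 \<or> 1 \<le> x \<Longrightarrow> bump x = 0"
  by (auto simp: bump_def flat_def)

lemma bump_pos: "0 < x \<Longrightarrow> x < 1 \<Longrightarrow> bump x > 0"
  by (auto simp: bump_def flat_def)

lemma bump_nonneg: "bump x \<ge> 0"
  by (auto simp: bump_def flat_def)

lemma bump_le_1: "bump x \<le> 1"
  unfolding bump_def flat_def by (auto intro!: mult_le_one)

lemma bump_in_flat_algebra: "bump \<in> flat_algebra"
proof -
  have "(\<lambda>x. flat 0 x * flat 0 ((-1) * x + 1)) \<in> flat_algebra"
    by (intro flat_algebra.intros)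
  moreover have "bump = (\<lambda>x. flat 0 x * flat 0 ((-1) * x + 1))"
    by (auto simp: bump_def)
  ultimately show ?thesis by simp
qed

lemma isCont_bump: "isCont bump x"
  using flat_algebra_has_derivative[OF bump_in_flat_algebra] DERIV_isCont by blast

lemma bump_antiderivative_exists:
  "\<exists>g. (\<forall>x. (g has_real_derivative bump x) (at x)) \<and> (\<forall>x\<le>0. g x = 0) \<and>
       (\<forall>x\<ge>1. g x = g 1) \<and> g 1 > (0::real)"
proof -
  obtain G where G: "\<And>x. (G has_real_derivative bump x) (at x)"
    using einterval_antiderivative[of "-\<infinity>" "\<infinity>" bump] isCont_bump
    by (auto simp: has_real_derivative_iff_has_vector_derivative)
  have G_within: "(G has_real_derivative 0) (at x within S)" if "x \<le> 0 \<or> 1 \<le> x" for x S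
    using G[of x] bump_eq_0[OF that] by (simp add: has_field_derivative_at_within)
  have left: "G x = G 0" if "x \<le> 0" for x
    using has_field_derivative_zero_constant[of "{..0::real}" G] G_within that by (metis (no_types, lifting) atMost_iff convex_real_interval(2) order_refl)
  have right: "G x = G 1" if "1 \<le> x" for x
    using has_field_derivative_zero_constant[of "{1::real..}" G] G_within that by (metis (no_types, lifting) atLeast_iff convex_real_interval(1) order_refl)
  have "G 0 < G 1"
  proof (rule DERIV_pos_imp_increasing_open[where f = G])
    show "continuous_on {0..1} G"
      by (intro continuous_at_imp_continuous_on ballI DERIV_isCont[OF G])
    show "\<exists>y. (G has_real_derivative y) (at x) \<and> 0 < y" if "0 < x" "x < 1" for x
      using G[of x] bump_pos[OF that] by blast
  qed simp
  show ?thesis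
  proof (intro exI conjI allI impI)
    show "((\<lambda>x. G x - G 0) has_real_derivative bump x) (at x)" for x
      using DERIV_diff[OF G DERIV_const] by simp
    show "G x - G 0 = 0" if "x \<le> 0" for x using left[OF that] by simp
    show "G x - G 0 = G 1 - G 0" if "1 \<le> x" for x using right[OF that] by simp
    show "0 < G 1 - G 0" using \<open>G 0 < G 1\<close> by simp
  qed
qed

text \<open>
  The primitive of \<open>bump\<close> that vanishes on the left; \<open>step 1\<close> is the mass of \<open>bump\<close>, which is not
  normalised to \<open>1\<close>.
\<close>

definition step :: "real \<Rightarrow> real" where
  "step = (SOME g. (\<forall>x. (g has_real_derivative bump x) (at x)) \<and> (\<forall>x\<le>0. g x = 0) \<and>
       (\<forall>x\<ge>1. g x = g 1) \<and> g 1 > 0)"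

lemma step_has_derivative: "(step has_real_derivative bump x) (at x)"
  and step_left: "x \<le> 0 \<Longrightarrow> step x = 0"
  and step_right: "1 \<le> x \<Longrightarrow> step x = step 1"
  and step_1_pos: "step 1 > 0"
  using someI_ex[OF bump_antiderivative_exists] unfolding step_def[symmetric] by blast+

text \<open>
  For \<open>k > 0\<close> the rise of \<open>ramp k t\<close>, and the mass of its derivative \<open>mollifier k t\<close>, sit in the interval
  \<open>[t - 1/k, t]\<close>. Placing it to the left of \<open>t\<close> makes left continuity enough to recover a value at
  \<open>t\<close>, and keeps the support inside \<open>I\<close> even when \<open>t\<close> is the right end of \<open>I\<close>.
\<close>

definition ramp :: "real \<Rightarrow> real \<Rightarrow> real \<Rightarrow> real" where
  "ramp k t x = step (k * (x - t) + 1)"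

definition mollifier :: "real \<Rightarrow> real \<Rightarrow> real \<Rightarrow> real" where
  "mollifier k t x = k * bump (k * (x - t) + 1)"

lemma ramp_has_derivative: "(ramp k t has_real_derivative mollifier k t x) (at x)"
  unfolding ramp_def mollifier_def
  by (rule DERIV_cong[OF DERIV_chain2[OF step_has_derivative]])
    (auto intro!: derivative_eq_intros simp: algebra_simps)

lemma mollifier_in_flat_algebra: "mollifier k t \<in> flat_algebra"
proof -
  have "(\<lambda>x. k * bump (k * x + (1 - k * t))) \<in> flat_algebra"
    by (intro flat_algebra_scale flat_algebra.affine bump_in_flat_algebra)
  then show ?thesis
    unfolding mollifier_def by (simp add: algebra_simps)
qed

lemma mollifier_eq_0:
  assumes "k > 0" "x \<le> t - 1 / k \<or> t \<le> x"
  shows "mollifier k t x = 0"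
  using assms(2)
proof
  assume "x \<le> t - 1 / k"
  then have "k * (x - t) + 1 \<le> 0" using assms(1) by (simp add: field_simps)
  then show ?thesis by (simp add: mollifier_def bump_eq_0)
next
  assume "t \<le> x"
  then show ?thesis using assms(1) by (simp add: mollifier_def bump_eq_0)
qed

lemma ramp_left: "k > 0 \<Longrightarrow> x \<le> t - 1 / k \<Longrightarrow> ramp k t x = 0"
  unfolding ramp_def by (rule step_left) (simp add: field_simps)

lemma ramp_right: "k > 0 \<Longrightarrow> t \<le> x \<Longrightarrow> ramp k t x = step 1"
  unfolding ramp_def by (rule step_right) simp

lemma mollifier_nonneg: "k > 0 \<Longrightarrow> mollifier k t x \<ge> 0"
  by (simp add: mollifier_def bump_nonneg)

lemma isCont_mollifier: "isCont (mollifier k t) x"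
  using flat_algebra_has_derivative[OF mollifier_in_flat_algebra] DERIV_isCont by blast

lemma mollifier_has_integral:
  assumes "k > 0" "{t - 1 / k..t} \<subseteq> I"
  shows "(mollifier k t has_integral step 1) I"
proof (rule has_integral_on_superset)
  have "(mollifier k t has_integral (ramp k t t - ramp k t (t - 1 / k))) {t - 1 / k..t}"
    using assms(1) ramp_has_derivative
    by (intro fundamental_theorem_of_calculus)
      (auto simp: has_real_derivative_iff_has_vector_derivative[symmetric] intro: has_field_derivative_at_within)
  then show "(mollifier k t has_integral step 1) {t - 1 / k..t}"
    using assms(1) by (simp add: ramp_left ramp_right)
qed (use assms mollifier_eq_0 in auto)

lemma mollified_abs_integrable:
  assumes "H absolutely_integrable_on I" "I \<in> sets lebesgue" "k > 0"
  shows "(\<lambda>x. H x * mollifier k t x) absolutely_integrable_on I"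
proof -
  have "mollifier k t \<in> borel_measurable (lebesgue_on I)"
    by (intro continuous_imp_measurable_on_sets_lebesgue assms(2) continuous_at_imp_continuous_on)
      (simp add: isCont_mollifier)
  moreover have "bounded (mollifier k t ` I)"
    using assms(3) bump_nonneg bump_le_1
    by (auto simp: bounded_iff mollifier_def abs_mult intro!: exI[of _ k])
  ultimately show ?thesis
    using absolutely_integrable_bounded_measurable_product_real[OF _ assms(2) _ assms(1), of "mollifier k t"]
    by (simp add: mult.commute)
qed

section \<open>Uniqueness of left continuous primitives\<close>

locale left_closed_interval =
  fixes a :: real and I :: "real set"
  assumes measurable: "I \<in> sets lebesgue"
    and lower_bound: "t \<in> I \<Longrightarrow> a \<le> t"
    and downward: "t \<in> I \<Longrightarrow> {a..t} \<subseteq> I"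
begin

text \<open>
  Averages over shrinking intervals to the left of a point of left continuity converge to the value
  there.
\<close>

lemma mollified_close:
  assumes H: "H absolutely_integrable_on I" and t: "t \<in> I" "a < t"
    and cont: "continuous (at_left t) H" and e: "e > 0"
  shows "\<forall>\<^sub>F k in at_top.
    \<bar>(LINT x:I|lebesgue. H x * mollifier k t x) - H t * step 1\<bar> \<le> e * step 1"
proof -
  have "(H \<longlongrightarrow> H t) (at_left t)" using cont by (simp add: continuous_within)
  then have "\<forall>\<^sub>F x in at_left t. \<bar>H x - H t\<bar> < e"
    using e by (auto simp: tendsto_iff dist_real_def)
  then obtain b where b: "b < t" "\<And>x. b < x \<Longrightarrow> x < t \<Longrightarrow> \<bar>H x - H t\<bar> < e"
    unfolding eventually_at_left_field by blast
  have "\<forall>\<^sub>F k in at_top. k > max (1 / (t - a)) (1 / (t - b))"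
    by (rule eventually_gt_at_top)
  then show ?thesis
  proof eventually_elim
    case (elim k)
    have k: "k > 0" using elim t by (smt (verit, best) zero_less_divide_1_iff)
    have ka: "a \<le> t - 1 / k" and kb: "b \<le> t - 1 / k"
      using elim k t b by (auto simp: field_simps)
    have sub: "{t - 1 / k..t} \<subseteq> I" using downward[OF t(1)] ka by auto
    have moll: "(mollifier k t has_integral step 1) I"
      using mollifier_has_integral[OF k sub] .
    have close: "norm ((H x - H t) * mollifier k t x) \<le> e * mollifier k t x" for x
    proof (cases "x \<le> t - 1 / k \<or> t \<le> x")
      case False
      then have "\<bar>H x - H t\<bar> \<le> e" using b(2)[of x] kb by auto
      then show ?thesis
        using mollifier_nonneg[OF k, of t x] by (simp add: abs_mult mult_right_mono)
    qed (simp add: mollifier_eq_0[OF k])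
    have HI: "(\<lambda>x. H x * mollifier k t x) absolutely_integrable_on I"
      by (rule mollified_abs_integrable[OF H measurable k])
    then have int: "((\<lambda>x. H x * mollifier k t x) has_integral (LINT x:I|lebesgue. H x * mollifier k t x)) I"
      by (rule has_integral_set_lebesgue)
    have diff: "((\<lambda>x. (H x - H t) * mollifier k t x) has_integral
        (LINT x:I|lebesgue. H x * mollifier k t x) - H t * step 1) I"
      using has_integral_diff[OF int has_integral_mult_right[OF moll, of "H t"]]
      by (simp add: left_diff_distrib)
    have "norm (integral I (\<lambda>x. (H x - H t) * mollifier k t x)) \<le> integral I (\<lambda>x. e * mollifier k t x)"
      using diff has_integral_mult_right[OF moll, of e] close
      by (intro integral_norm_bound_integral) (auto simp: integrable_on_def)
    then show ?case
      unfolding integral_unique[OF diff] integral_unique[OF has_integral_mult_right[OF moll, of e]]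
      by simp
  qed
qed

text \<open>
  A single ramp is not compactly supported; the difference of two is, since both end at height
  \<open>step 1\<close>.
\<close>

lemma ramp_difference_test_functions:
  assumes k: "k > 0" "a \<le> s - 1 / k" and st: "s < t" "t \<in> I"
  defines "\<phi> \<equiv> \<lambda>x. ramp k s x - ramp k t x"
  shows "\<phi> \<in> test_functions I" "deriv \<phi> \<in> test_functions I"
    "deriv \<phi> = (\<lambda>x. mollifier k s x - mollifier k t x)"
proof -
  let ?d = "\<lambda>x. mollifier k s x - mollifier k t x"
  have der: "(\<phi> has_real_derivative ?d x) (at x)" for x
    unfolding \<phi>_def by (intro DERIV_diff ramp_has_derivative)
  then show deriv: "deriv \<phi> = ?d" by (auto intro!: DERIV_imp_deriv)
  have d: "?d \<in> flat_algebra"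
    using flat_algebra.add[OF mollifier_in_flat_algebra[of k s] flat_algebra_scale[OF mollifier_in_flat_algebra, of "-1" k t]]
    by simp
  have supp: "compact (supp \<psi>) \<and> supp \<psi> \<subseteq> I"
    if "\<And>x. x \<le> s - 1 / k \<or> t \<le> x \<Longrightarrow> \<psi> x = 0" for \<psi>
  proof -
    have "x \<in> {s - 1 / k..t}" if "\<psi> x \<noteq> 0" for x
      using that \<open>\<And>x. x \<le> s - 1 / k \<or> t \<le> x \<Longrightarrow> \<psi> x = 0\<close>[of x]
      by (metis atLeastAtMost_iff linorder_le_cases)
    then have "{x. \<psi> x \<noteq> 0} \<subseteq> {s - 1 / k..t}" by blast
    then have *: "supp \<psi> \<subseteq> {s - 1 / k..t}" unfolding supp_def by (simp add: closure_minimal)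
    then have "compact (supp \<psi>)"
      unfolding supp_def
      by (meson bounded_closed_interval bounded_subset closed_closure compact_eq_bounded_closed)
    with * show ?thesis using downward[OF st(2)] k by force
  qed
  have "\<phi> x = 0" if "x \<le> s - 1 / k \<or> t \<le> x" for x
    using that k st by (auto simp: \<phi>_def ramp_left ramp_right)
  from supp[OF this] show "\<phi> \<in> test_functions I"
    using antiderivative_smooth[OF d der] by (auto simp: test_functions_def)
  have "?d x = 0" if "x \<le> s - 1 / k \<or> t \<le> x" for x
    using that k st by (auto simp: mollifier_eq_0)
  from supp[OF this] show "deriv \<phi> \<in> test_functions I"
    using flat_algebra_smooth[OF d] unfolding deriv by (auto simp: test_functions_def)
qed

text \<open>
  Pairing the difference \<open>H\<close> of the two functions with the derivative of a ramp difference gives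
  zero, and this pairing is the difference of averages of \<open>H\<close> just left of \<open>s\<close> and just left of \<open>t\<close>.
\<close>

lemma same_derivative_same_increment:
  assumes F: "F \<in> Llc a I" and G: "G \<in> Llc a I"
    and eq: "dist_deriv I (dist_of I F) = dist_deriv I (dist_of I G)"
    and st: "a < s" "s < t" "t \<in> I"
  shows "F s - G s = F t - G t"
proof (rule ccontr)
  define H where "H x = F x - G x" for x
  assume "F s - G s \<noteq> F t - G t"
  then have ne: "H s \<noteq> H t" by (simp add: H_def)
  \<comment> \<open>The two averages coincide, so \<open>H s\<close> and \<open>H t\<close> differ by at most \<open>2 * e\<close>.\<close>
  define e where "e = \<bar>H s - H t\<bar> / 3"
  have e: "e > 0" using ne by (simp add: e_def)
  have at: "a < t" using st by simp
  have s: "s \<in> I" using downward[OF st(3)] st by auto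
  have H: "H absolutely_integrable_on I"
    unfolding H_def using F G by (auto simp: Llc_def intro!: set_integral_diff)
  have cont: "continuous (at_left r) H" if "r \<in> I" "a < r" for r
    unfolding H_def using F G that by (auto simp: Llc_def intro!: continuous_diff)
  have "\<forall>\<^sub>F k in at_top. k > max 0 (1 / (s - a))" by (rule eventually_gt_at_top)
  then have "\<forall>\<^sub>F k::real in at_top. \<bar>H s * step 1 - H t * step 1\<bar> \<le> 2 * e * step 1"
    using mollified_close[OF H s st(1) cont[OF s st(1)] e]
      mollified_close[OF H st(3) at cont[OF st(3) at] e]
  proof eventually_elim
    case (elim k)
    have k: "k > 0" using elim(1) by simp
    then have ks: "a \<le> s - 1 / k" using elim(1) st by (simp add: field_simps)
    let ?\<phi> = "\<lambda>x. ramp k s x - ramp k t x"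
    note test = ramp_difference_test_functions[OF k ks st(2,3)]
    have split: "(LINT x:I|lebesgue. K x * deriv ?\<phi> x) =
        (LINT x:I|lebesgue. K x * mollifier k s x) - (LINT x:I|lebesgue. K x * mollifier k t x)"
      if "K absolutely_integrable_on I" for K
      unfolding test(3) using mollified_abs_integrable[OF that measurable k]
      by (simp add: right_diff_distrib set_integral_diff)
    have dist: "dist_deriv I (dist_of I K) ?\<phi> = - (LINT x:I|lebesgue. K x * deriv ?\<phi> x)" for K
      using test(1,2) by (simp add: dist_deriv_def dist_of_def)
    have FI: "F absolutely_integrable_on I" and GI: "G absolutely_integrable_on I"
      using F G by (auto simp: Llc_def)
    have FGr: "(LINT x:I|lebesgue. H x * mollifier k r x) =
       (LINT x:I|lebesgue. F x * mollifier k r x) - (LINT x:I|lebesgue. G x * mollifier k r x)" for r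
      unfolding H_def
      using mollified_abs_integrable[OF FI measurable k] mollified_abs_integrable[OF GI measurable k]
      by (simp add: left_diff_distrib set_integral_diff)
    have "(LINT x:I|lebesgue. F x * deriv ?\<phi> x) = (LINT x:I|lebesgue. G x * deriv ?\<phi> x)"
      using fun_cong[OF eq, of ?\<phi>] by (simp add: dist)
    then have "(LINT x:I|lebesgue. H x * mollifier k s x) = (LINT x:I|lebesgue. H x * mollifier k t x)"
      by (simp add: split[OF FI] split[OF GI] FGr)
    with elim st show ?case by (simp add: algebra_simps)
  qed
  then have "\<bar>H s * step 1 - H t * step 1\<bar> \<le> 2 * e * step 1" by simp
  then have "\<bar>H s - H t\<bar> * step 1 \<le> 2 * e * step 1"
    using step_1_pos by (simp add: left_diff_distrib[symmetric] abs_mult)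
  then have "\<bar>H s - H t\<bar> \<le> 2 * e" using step_1_pos by simp
  then show False using e by (simp add: e_def)
qed

text \<open>
  The difference is constant to the right of \<open>a\<close>; right continuity at \<open>a\<close> and the initial value \<open>0\<close>
  identify the constant.
\<close>

lemma same_derivative_eq:
  assumes F: "F \<in> Llc0 a I" and G: "G \<in> Llc0 a I"
    and eq: "dist_deriv I (dist_of I F) = dist_deriv I (dist_of I G)"
  shows "F = G"
proof -
  have FL: "F \<in> Llc a I" and GL: "G \<in> Llc a I" and Fa: "F a = 0" and Ga: "G a = 0"
    using F G by (auto simp: Llc0_def)
  have zero: "F t - G t = 0" if t: "t \<in> I" "a < t" for t
  proof -
    have "((\<lambda>s. F s - G s) \<longlongrightarrow> F a - G a) (at_right a)"
      using FL GL by (auto simp: Llc_def continuous_within intro!: tendsto_diff)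
    moreover have "\<forall>\<^sub>F s in at_right a. F s - G s = F t - G t"
      unfolding eventually_at_right_field
      using same_derivative_same_increment[OF FL GL eq] t by blast
    ultimately have "((\<lambda>s. F t - G t) \<longlongrightarrow> F a - G a) (at_right a)"
      by (rule Lim_transform_eventually)
    then show ?thesis
      using Fa Ga by (simp add: tendsto_const_iff)
  qed
  have "F t = G t" if "t \<in> I" for t
    using zero[OF that] lower_bound[OF that] Fa Ga by (cases "t = a") auto
  then show ?thesis
    using FL GL by (intro extensionalityI[of _ I]) (auto simp: Llc_def)
qed

lemma primitive_eqI:
  assumes "F \<in> Llc0 a I" "g = dist_deriv I (dist_of I F)"
  shows "primitive a I g = F"
  unfolding primitive_def using assms same_derivative_eq by (intro the_equality) auto

lemma AL_primitive:
  assumes "g \<in> AL a I"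
  shows "primitive a I g \<in> Llc0 a I" "dist_deriv I (dist_of I (primitive a I g)) = g"
proof -
  obtain F where "F \<in> Llc0 a I" "g = dist_deriv I (dist_of I F)"
    using assms by (auto simp: AL_def)
  with primitive_eqI[OF this]
  show "primitive a I g \<in> Llc0 a I" "dist_deriv I (dist_of I (primitive a I g)) = g" by auto
qed

end


section \<open>Increasing sequences and maximal elements in an \<open>L\<^sup>1\<close> ball\<close>

text \<open>
  The Beppo Levi theorem. The nonnegative functions \<open>f n - f 0\<close> have a supremum with values in
  \<open>[0, \<infinity>]\<close>, and the bound on the integrals makes it finite almost everywhere.
\<close>

lemma beppo_levi_increasing:
  fixes f :: "nat \<Rightarrow> 'a \<Rightarrow> real"
  assumes f: "\<And>n. integrable M (f n)"
    and mono: "\<And>n. AE x in M. f n x \<le> f (Suc n) x"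
    and bound: "\<And>n. (LINT x|M. f n x) \<le> K"
  shows "\<exists>u. integrable M u \<and> (AE x in M. mono (\<lambda>n. f n x) \<and> (\<lambda>n. f n x) \<longlonglongrightarrow> u x)"
proof -
  have [measurable]: "f n \<in> borel_measurable M" for n using f by auto
  have AE_mono: "AE x in M. mono (\<lambda>n. f n x)"
    using mono by (simp add: mono_iff_le_Suc AE_all_countable)
  let ?g = "\<lambda>n x. ennreal (f n x - f 0 x)"
  have g: "(\<integral>\<^sup>+x. ?g n x \<partial>M) \<le> ennreal (K - (LINT x|M. f 0 x))" for n
  proof -
    have "AE x in M. 0 \<le> f n x - f 0 x"
      using AE_mono
    proof eventually_elim
      case (elim x)
      then show ?case using incseqD[of "\<lambda>n. f n x" 0 n] by simp
    qed
    then have "(\<integral>\<^sup>+x. ?g n x \<partial>M) = ennreal (LINT x|M. f n x - f 0 x)"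
      using f by (intro nn_integral_eq_integral) auto
    also have "\<dots> \<le> ennreal (K - (LINT x|M. f 0 x))"
      using bound[of n] f by (intro ennreal_leI) simp
    finally show ?thesis .
  qed
  have "(\<integral>\<^sup>+x. (SUP n. ?g n x) \<partial>M) = (SUP n. \<integral>\<^sup>+x. ?g n x \<partial>M)"
    using AE_mono
    by (intro nn_integral_monotone_convergence_SUP_AE)
      (auto intro!: ennreal_leI simp: mono_iff_le_Suc elim!: eventually_mono)
  also have "\<dots> \<le> ennreal (K - (LINT x|M. f 0 x))" using g by (intro SUP_least)
  also have "\<dots> < \<infinity>" by simp
  finally have "AE x in M. (SUP n. ?g n x) \<noteq> \<infinity>"
    by (intro nn_integral_PInf_AE) auto
  with AE_mono have AE_conv: "AE x in M. mono (\<lambda>n. f n x) \<and> convergent (\<lambda>n. f n x)"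
  proof eventually_elim
    case (elim x)
    then obtain B where B: "(SUP n. ?g n x) = ennreal B" "B \<ge> 0"
      by (cases "SUP n. ?g n x") auto
    have "f n x \<le> f 0 x + B" for n
    proof -
      have "?g n x \<le> ennreal B" using SUP_upper[of n UNIV "\<lambda>n. ?g n x"] B by simp
      then show ?thesis using B(2) by (simp add: ennreal_le_iff)
    qed
    then obtain l where "(\<lambda>n. f n x) \<longlonglongrightarrow> l"
      using incseq_convergent[OF elim(1)] by blast
    then show ?case using elim(1) convergentI by blast
  qed
  let ?u = "\<lambda>x. lim (\<lambda>n. f n x)"
  have conv: "AE x in M. mono (\<lambda>n. f n x) \<and> (\<lambda>n. f n x) \<longlonglongrightarrow> ?u x"
    using AE_conv by eventually_elim (simp add: convergent_LIMSEQ_iff)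
  have inc: "mono (\<lambda>n. LINT x|M. f n x)"
    by (intro incseq_SucI integral_mono_AE f mono)
  obtain l where "(\<lambda>n. LINT x|M. f n x) \<longlonglongrightarrow> l"
    using incseq_convergent[OF inc] bound by blast
  then have "integrable M ?u"
    using conv
    by (intro integrable_monotone_convergence[where f = f and u = ?u, OF f])
      (auto elim: eventually_mono)
  with conv show ?thesis by blast
qed

text \<open>
  The Brezis--Browder ordering principle. Choose an increasing sequence whose next term nearly
  maximises \<open>\<phi>\<close> among the elements above the current one; above an upper bound of the sequence
  there is then no room for \<open>\<phi>\<close> to grow. Antisymmetry of \<open>le\<close> is not assumed, so that
  the principle applies to functions ordered almost everywhere, without passing to classes.
\<close>

lemma brezis_browder:
  fixes le :: "'a \<Rightarrow> 'a \<Rightarrow> bool" and \<phi> :: "'a \<Rightarrow> real"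
  assumes "S \<noteq> {}"
    and refl: "\<And>x. x \<in> S \<Longrightarrow> le x x"
    and trans: "\<And>x y z. \<lbrakk>x \<in> S; y \<in> S; z \<in> S; le x y; le y z\<rbrakk> \<Longrightarrow> le x z"
    and mono: "\<And>x y. \<lbrakk>x \<in> S; y \<in> S; le x y\<rbrakk> \<Longrightarrow> \<phi> x \<le> \<phi> y"
    and bound: "\<And>x. x \<in> S \<Longrightarrow> \<phi> x \<le> K"
    and chain: "\<And>c. \<lbrakk>\<And>n. c n \<in> S; \<And>n. le (c n) (c (Suc n))\<rbrakk> \<Longrightarrow> \<exists>s\<in>S. \<forall>n::nat. le (c n) s"
  shows "\<exists>x\<in>S. \<forall>y\<in>S. le x y \<longrightarrow> \<phi> y = \<phi> x"
proof -
  have step: "\<exists>y. y \<in> S \<and> (le x y \<and> (\<forall>z\<in>S. le x z \<longrightarrow> \<phi> z \<le> \<phi> y + 1 / Suc n))" if x: "x \<in> S" for x and n :: nat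
  proof -
    let ?A = "\<phi> ` {z \<in> S. le x z}"
    have A: "?A \<noteq> {}" "bdd_above ?A"
      using refl x bound by (auto intro!: bdd_aboveI[of _ K])
    have "Sup ?A - 1 / Suc n < Sup ?A" by simp
    then obtain y where y: "y \<in> S" "le x y" "Sup ?A - 1 / Suc n < \<phi> y"
      using less_cSup_iff[OF A] by auto
    have "\<phi> z \<le> Sup ?A" if "z \<in> S" "le x z" for z
      using that A by (intro cSup_upper) auto
    with y show ?thesis by force
  qed
  obtain x0 where x0: "x0 \<in> S" using assms(1) by blast
  obtain c where c: "\<And>n. c n \<in> S" "\<And>n. le (c n) (c (Suc n))"
      "\<And>n z. z \<in> S \<Longrightarrow> le (c n) z \<Longrightarrow> \<phi> z \<le> \<phi> (c (Suc n)) + 1 / Suc n"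
    using dependent_nat_choice[of "\<lambda>_ x. x \<in> S"
        "\<lambda>n x y. le x y \<and> (\<forall>z\<in>S. le x z \<longrightarrow> \<phi> z \<le> \<phi> y + 1 / Suc n)"] x0 step by blast
  obtain s where s: "s \<in> S" "\<And>n. le (c n) s" using chain[where c = c, OF c(1,2)] by blast
  show ?thesis
  proof (intro bexI[OF _ s(1)] ballI impI antisym)
    fix y assume y: "y \<in> S" "le s y"
    show "\<phi> s \<le> \<phi> y" using mono s(1) y by blast
    show "\<phi> y \<le> \<phi> s"
    proof (rule field_le_epsilon)
      fix e :: real assume "e > 0"
      then obtain n where n: "1 / Suc n < e" by (rule nat_approx_posE)
      have "\<phi> y \<le> \<phi> (c (Suc n)) + 1 / Suc n"
        using c(3)[OF y(1) trans[OF c(1) s(1) y(1) s(2) y(2)]] .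
      also have "\<dots> \<le> \<phi> s + e"
        using mono[OF c(1) s(1) s(2), of "Suc n"] n by linarith
      finally show "\<phi> y \<le> \<phi> s + e" .
    qed
  qed
qed

definition L1_fun :: "real set \<Rightarrow> ('m::finite \<Rightarrow> real \<Rightarrow> real) set" where
  "L1_fun I = {x. \<forall>i. x i absolutely_integrable_on I}"

definition ae_le :: "real set \<Rightarrow> ('m::finite \<Rightarrow> real \<Rightarrow> real) \<Rightarrow> ('m \<Rightarrow> real \<Rightarrow> real) \<Rightarrow> bool" where
  "ae_le I x y \<longleftrightarrow> (\<forall>i. AE s in lebesgue. s \<in> I \<longrightarrow> x i s \<le> y i s)"

definition L1_ball :: "real set \<Rightarrow> real \<Rightarrow> ('m::finite \<Rightarrow> real \<Rightarrow> real) set" where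
  "L1_ball I R = {x \<in> L1_fun I. \<forall>i. (LINT s:I|lebesgue. \<bar>x i s\<bar>) \<le> R}"

lemma ae_le_refl: "ae_le I x x"
  by (simp add: ae_le_def)

lemma ae_le_trans: "ae_le I x y \<Longrightarrow> ae_le I y z \<Longrightarrow> ae_le I x z"
  unfolding ae_le_def
proof
  fix i assume "\<forall>i. AE s in lebesgue. s \<in> I \<longrightarrow> x i s \<le> y i s" "\<forall>i. AE s in lebesgue. s \<in> I \<longrightarrow> y i s \<le> z i s"
  then have "AE s in lebesgue. s \<in> I \<longrightarrow> x i s \<le> y i s" "AE s in lebesgue. s \<in> I \<longrightarrow> y i s \<le> z i s" by auto
  then show "AE s in lebesgue. s \<in> I \<longrightarrow> x i s \<le> z i s" by eventually_elim auto
qed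

lemma L1_ball_uminus: "x \<in> L1_ball I R \<Longrightarrow> (\<lambda>i s. - x i s) \<in> L1_ball I R"
  by (simp add: L1_ball_def L1_fun_def set_integrable_def)

lemma L1_ball_pos_part:
  assumes "x \<in> L1_ball I R"
  shows "(\<lambda>i s. max 0 (x i s)) \<in> L1_ball I R"
proof -
  have x: "x i absolutely_integrable_on I" "(LINT s:I|lebesgue. \<bar>x i s\<bar>) \<le> R" for i
    using assms by (auto simp: L1_ball_def L1_fun_def)
  have m: "(\<lambda>s. max 0 (x i s)) absolutely_integrable_on I" for i
  proof -
    have eq: "(\<lambda>s. max 0 (x i s)) = (\<lambda>s. (x i s + \<bar>x i s\<bar>) * (1/2))"
      by (auto simp: max_def)
    show ?thesis
      unfolding eq using x(1)[of i]
      by (intro set_integrable_mult_left set_integral_add set_integrable_abs)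
  qed
  have "(LINT s:I|lebesgue. \<bar>max 0 (x i s)\<bar>) \<le> (LINT s:I|lebesgue. \<bar>x i s\<bar>)" for i
    using set_integrable_abs[OF m[of i]] set_integrable_abs[OF x(1)[of i]] by (intro set_integral_mono) auto
  then show ?thesis
    using m x(2) by (auto simp: L1_ball_def L1_fun_def intro: order_trans)
qed

lemma set_integral_le_set_integral_abs:
  fixes x :: "real \<Rightarrow> real"
  assumes "x absolutely_integrable_on I"
  shows "(LINT s:I|lebesgue. x s) \<le> (LINT s:I|lebesgue. \<bar>x s\<bar>)"
  using assms by (intro set_integral_mono set_integrable_abs) auto

lemma set_integral_mono_ae:
  fixes x y :: "real \<Rightarrow> real"
  assumes "x absolutely_integrable_on I" "y absolutely_integrable_on I"
    "AE s in lebesgue. s \<in> I \<longrightarrow> x s \<le> y s"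
  shows "(LINT s:I|lebesgue. x s) \<le> (LINT s:I|lebesgue. y s)"
  unfolding set_lebesgue_integral_def
  using assms
  by (intro integral_mono_AE) (auto simp: set_integrable_def indicator_def elim!: eventually_mono)

lemma ae_eq_if_le_and_integral_eq:
  fixes x y :: "real \<Rightarrow> real"
  assumes x: "x absolutely_integrable_on I" and y: "y absolutely_integrable_on I"
    and le: "AE s in lebesgue. s \<in> I \<longrightarrow> x s \<le> y s"
    and int: "(LINT s:I|lebesgue. y s) \<le> (LINT s:I|lebesgue. x s)"
  shows "AE s in lebesgue. s \<in> I \<longrightarrow> y s \<le> x s"
proof -
  let ?d = "\<lambda>s. indicator I s *\<^sub>R (y s - x s)"
  have d: "integrable lebesgue ?d"
    using set_integral_diff(1)[OF y x] by (simp add: set_integrable_def)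
  have nonneg: "AE s in lebesgue. 0 \<le> ?d s"
    using le by eventually_elim (auto simp: indicator_def)
  have "(LINT s|lebesgue. ?d s) = (LINT s:I|lebesgue. y s) - (LINT s:I|lebesgue. x s)"
    using set_integral_diff(2)[OF y x] by (simp add: set_lebesgue_integral_def)
  then have "(LINT s|lebesgue. ?d s) = 0"
    using int integral_nonneg_AE[OF nonneg] by simp
  then have "AE s in lebesgue. ?d s = 0"
    using integral_nonneg_eq_0_iff_AE[OF d nonneg] by simp
  then show ?thesis by eventually_elim (auto simp: indicator_def)
qed

text \<open>
  The supremum is the almost everywhere limit. It stays in the ball because the sequence is dominated
  by its first term and its limit, so that the norms converge.
\<close>

lemma increasing_sequence_in_L1_ball:
  fixes c :: "nat \<Rightarrow> 'm::finite \<Rightarrow> real \<Rightarrow> real"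
  assumes I: "I \<in> sets lebesgue" and c: "\<And>n. c n \<in> L1_ball I R" and inc: "\<And>n. ae_le I (c n) (c (Suc n))"
  shows "\<exists>u\<in>L1_ball I R. (\<forall>n. ae_le I (c n) u) \<and> (\<forall>v. (\<forall>n. ae_le I (c n) v) \<longrightarrow> ae_le I u v)"
proof -
  have cint: "c n i absolutely_integrable_on I" and cnorm: "(LINT s:I|lebesgue. \<bar>c n i s\<bar>) \<le> R" for n i
    using c[of n] by (auto simp: L1_ball_def L1_fun_def)
  let ?f = "\<lambda>i n s. indicator I s *\<^sub>R c n i s"
  have f: "integrable lebesgue (?f i n)" for i n
    using cint[of n i] by (simp add: set_integrable_def)
  have "\<exists>v. integrable lebesgue v \<and> (AE s in lebesgue. mono (\<lambda>n. ?f i n s) \<and> (\<lambda>n. ?f i n s) \<longlonglongrightarrow> v s)" for i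
  proof (rule beppo_levi_increasing[OF f])
    show "AE s in lebesgue. ?f i n s \<le> ?f i (Suc n) s" for n
    proof -
      have "AE s in lebesgue. s \<in> I \<longrightarrow> c n i s \<le> c (Suc n) i s"
        using inc[of n] by (simp add: ae_le_def)
      then show ?thesis by eventually_elim (auto simp: indicator_def)
    qed
    show "(LINT s|lebesgue. ?f i n s) \<le> R" for n
      using set_integral_le_set_integral_abs[OF cint] cnorm[of n i]
      unfolding set_lebesgue_integral_def by (rule order_trans)
  qed
  then have "\<exists>u. \<forall>i. integrable lebesgue (u i) \<and>
      (AE s in lebesgue. mono (\<lambda>n. ?f i n s) \<and> (\<lambda>n. ?f i n s) \<longlonglongrightarrow> u i s)"
    by (intro choice allI)
  then obtain u where u: "\<And>i. integrable lebesgue (u i)"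
    "\<And>i. AE s in lebesgue. mono (\<lambda>n. ?f i n s) \<and> (\<lambda>n. ?f i n s) \<longlonglongrightarrow> u i s" by blast
  have supported: "AE s in lebesgue. indicator I s *\<^sub>R u i s = u i s" for i
    using u(2)[of i] by eventually_elim (auto simp: indicator_def LIMSEQ_const_iff)
  have uint: "u i absolutely_integrable_on I" for i
    unfolding set_integrable_def
    by (rule integrable_mult_indicator[OF I u(1)])
  have abs_lim: "(\<lambda>n. LINT s|lebesgue. \<bar>?f i n s\<bar>) \<longlonglongrightarrow> (LINT s|lebesgue. \<bar>u i s\<bar>)" for i
  proof (rule integral_dominated_convergence[where w = "\<lambda>s. \<bar>?f i 0 s\<bar> + \<bar>u i s\<bar>"])
    show "AE s in lebesgue. norm \<bar>?f i n s\<bar> \<le> \<bar>?f i 0 s\<bar> + \<bar>u i s\<bar>" for n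
      using u(2)[of i]
    proof eventually_elim
      case (elim s)
      then have "?f i 0 s \<le> ?f i n s" "?f i n s \<le> u i s"
        using monoD[of "\<lambda>n. ?f i n s" 0 n] incseq_le[of "\<lambda>n. ?f i n s" "u i s" n] by auto
      then show ?case by auto
    qed
    show "AE s in lebesgue. (\<lambda>n. \<bar>?f i n s\<bar>) \<longlonglongrightarrow> \<bar>u i s\<bar>"
      using u(2)[of i] by eventually_elim (auto intro: tendsto_rabs)
  qed (use u(1) f in auto)
  have "(LINT s:I|lebesgue. \<bar>u i s\<bar>) \<le> R" for i
  proof -
    have "(LINT s:I|lebesgue. \<bar>u i s\<bar>) = (LINT s|lebesgue. \<bar>u i s\<bar>)"
      unfolding set_lebesgue_integral_def
    proof (rule integral_cong_AE)
      show "AE s in lebesgue. indicator I s *\<^sub>R \<bar>u i s\<bar> = \<bar>u i s\<bar>"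
        using supported[of i] by eventually_elim (auto simp: indicator_def split: if_splits)
      show "(\<lambda>s. indicator I s *\<^sub>R \<bar>u i s\<bar>) \<in> borel_measurable lebesgue"
        using integrable_mult_indicator[OF I integrable_abs[OF u(1)[of i]]] by blast
    qed (use u(1)[of i] in auto)
    also have "\<dots> \<le> R"
      using abs_lim[of i] cnorm
      by (intro LIMSEQ_le_const2[OF abs_lim]) (auto simp: set_lebesgue_integral_def abs_mult)
    finally show ?thesis .
  qed
  with uint have "u \<in> L1_ball I R" by (auto simp: L1_ball_def L1_fun_def)
  moreover have "ae_le I (c n) u" for n
    unfolding ae_le_def
  proof
    show "AE s in lebesgue. s \<in> I \<longrightarrow> c n i s \<le> u i s" for i
      using u(2)[of i]
    proof eventually_elim
      case (elim s)
      then show ?case using incseq_le[of "\<lambda>n. ?f i n s" "u i s" n] by auto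
    qed
  qed
  moreover have "ae_le I u v" if v: "\<forall>n. ae_le I (c n) v" for v
    unfolding ae_le_def
  proof
    fix i
    have "AE s in lebesgue. \<forall>n. s \<in> I \<longrightarrow> c n i s \<le> v i s"
      using v unfolding ae_le_def AE_all_countable by blast
    with u(2)[of i] show "AE s in lebesgue. s \<in> I \<longrightarrow> u i s \<le> v i s"
    proof eventually_elim
      case (elim s)
      then show ?case using LIMSEQ_le_const2[of "\<lambda>n. c n i s" "u i s" "v i s"] by auto
    qed
  qed
  ultimately show ?thesis by blast
qed

text \<open>
  The functional for the ordering principle is the sum of the integrals of the components: for
  comparable tuples, equality of these sums forces equality almost everywhere.
\<close>

lemma ae_maximal_exists:
  fixes S :: "('m::finite \<Rightarrow> real \<Rightarrow> real) set"
  assumes I: "I \<in> sets lebesgue" and ne: "S \<noteq> {}" and ball: "S \<subseteq> L1_ball I R"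
    and closed: "\<And>c u. \<lbrakk>\<And>n::nat. c n \<in> S; u \<in> L1_ball I R; \<And>n. ae_le I (c n) u;
        \<And>v. (\<And>n. ae_le I (c n) v) \<Longrightarrow> ae_le I u v\<rbrakk> \<Longrightarrow> u \<in> S"
  shows "\<exists>x\<in>S. \<forall>y\<in>S. ae_le I x y \<longrightarrow> ae_le I y x"
proof -
  define \<phi> where "\<phi> x = (\<Sum>i\<in>UNIV. LINT s:I|lebesgue. x i s)" for x :: "'m \<Rightarrow> real \<Rightarrow> real"
  have int: "x i absolutely_integrable_on I" and norm: "(LINT s:I|lebesgue. \<bar>x i s\<bar>) \<le> R" if "x \<in> S" for x i
    using that ball by (auto simp: L1_ball_def L1_fun_def)
  have comp: "(LINT s:I|lebesgue. x i s) \<le> (LINT s:I|lebesgue. y i s)"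
    if "x \<in> S" "y \<in> S" "ae_le I x y" for x y i
    using that int by (intro set_integral_mono_ae) (auto simp: ae_le_def)
  have "\<exists>x\<in>S. \<forall>y\<in>S. ae_le I x y \<longrightarrow> \<phi> y = \<phi> x"
  proof (rule brezis_browder[where K = "\<Sum>i\<in>(UNIV::'m set). R"])
    show "\<phi> x \<le> \<phi> y" if "x \<in> S" "y \<in> S" "ae_le I x y" for x y
      unfolding \<phi>_def using comp[OF that] by (intro sum_mono)
    show "\<phi> x \<le> (\<Sum>i\<in>(UNIV::'m set). R)" if "x \<in> S" for x
      unfolding \<phi>_def
      by (intro sum_mono order_trans[OF set_integral_le_set_integral_abs norm] int that)
    show "\<exists>s\<in>S. \<forall>n::nat. ae_le I (c n) s"
      if c: "\<And>n. c n \<in> S" "\<And>n. ae_le I (c n) (c (Suc n))" for c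
    proof -
      have "\<And>n. c n \<in> L1_ball I R" using c(1) ball by auto
      from increasing_sequence_in_L1_ball[where c = c, OF I this c(2)] obtain u where
        "u \<in> L1_ball I R" "\<forall>n. ae_le I (c n) u" "\<forall>v. (\<forall>n. ae_le I (c n) v) \<longrightarrow> ae_le I u v" by blast
      then show ?thesis using closed[of c u] c(1) by blast
    qed
  qed (use ne ae_le_refl ae_le_trans in blast)+
  then obtain x where x: "x \<in> S" "\<And>y. y \<in> S \<Longrightarrow> ae_le I x y \<Longrightarrow> \<phi> y = \<phi> x" by blast
  have "ae_le I y x" if y: "y \<in> S" "ae_le I x y" for y
    unfolding ae_le_def
  proof
    fix i
    have "(LINT s:I|lebesgue. y i s) = (LINT s:I|lebesgue. x i s)"
    proof (rule ccontr)
      assume "(LINT s:I|lebesgue. y i s) \<noteq> (LINT s:I|lebesgue. x i s)"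
      then have "(LINT s:I|lebesgue. x i s) < (LINT s:I|lebesgue. y i s)"
        using comp[OF x(1) y, of i] by simp
      then have "\<exists>i\<in>UNIV. (LINT s:I|lebesgue. x i s) < (LINT s:I|lebesgue. y i s)"
        by blast
      with comp[OF x(1) y] have "\<phi> x < \<phi> y"
        unfolding \<phi>_def by (intro sum_strict_mono_ex1) simp_all
      then show False using x(2)[OF y] by simp
    qed
    then show "AE s in lebesgue. s \<in> I \<longrightarrow> y i s \<le> x i s"
      using ae_eq_if_le_and_integral_eq[OF int[OF x(1)] int[OF y(1)], of i i] y(2)
      by (simp add: ae_le_def)
  qed
  with x(1) show ?thesis by blast
qed

section \<open>Extremal fixed points of increasing maps on an \<open>L\<^sup>1\<close> ball\<close>

locale increasing_on_ball =
  fixes I :: "real set" and R :: real and T :: "('m::finite \<Rightarrow> real \<Rightarrow> real) \<Rightarrow> 'm \<Rightarrow> real \<Rightarrow> real"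
  assumes measurable: "I \<in> sets lebesgue" and R_nonneg: "R \<ge> 0"
    and maps: "x \<in> L1_ball I R \<Longrightarrow> T x \<in> L1_ball I R"
    and increasing: "\<lbrakk>x \<in> L1_ball I R; y \<in> L1_ball I R; ae_le I x y\<rbrakk> \<Longrightarrow> ae_le I (T x) (T y)"
begin

text \<open>Conjugation with \<open>x \<mapsto> - x\<close> reverses the order and preserves the ball.\<close>

lemma dual: "increasing_on_ball I R (\<lambda>x i s. - T (\<lambda>j r. - x j r) i s)"
proof
  show "(\<lambda>i s. - T (\<lambda>j r. - x j r) i s) \<in> L1_ball I R" if "x \<in> L1_ball I R" for x
    by (intro L1_ball_uminus maps that)
  show "ae_le I (\<lambda>i s. - T (\<lambda>j r. - x j r) i s) (\<lambda>i s. - T (\<lambda>j r. - y j r) i s)"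
    if "x \<in> L1_ball I R" "y \<in> L1_ball I R" "ae_le I x y" for x y
    using increasing[OF L1_ball_uminus[OF that(2)] L1_ball_uminus[OF that(1)]] that(3)
    by (simp add: ae_le_def)
qed (rule measurable R_nonneg)+

text \<open>
  The positive part makes \<open>0\<close> a starting point: \<open>0 \<le> max 0 (T 0)\<close> holds although \<open>0\<close> and \<open>T 0\<close> need not
  be comparable. A maximal \<open>x\<close> below \<open>max 0 (T x)\<close> must equal it, as \<open>x \<mapsto> max 0 (T x)\<close> is increasing.
\<close>

lemma upper_point_exists: "\<exists>x\<in>L1_ball I R. ae_le I (T x) x"
proof -
  let ?P = "\<lambda>x i s. max 0 (T x i s)"
  let ?S = "{x \<in> L1_ball I R. ae_le I x (?P x)}"
  have P_ball: "?P x \<in> L1_ball I R" if "x \<in> L1_ball I R" for x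
    by (intro L1_ball_pos_part maps that)
  have P_mono: "ae_le I (?P x) (?P y)" if "x \<in> L1_ball I R" "y \<in> L1_ball I R" "ae_le I x y" for x y
    unfolding ae_le_def
  proof
    fix i
    have "AE s in lebesgue. s \<in> I \<longrightarrow> T x i s \<le> T y i s"
      using increasing[OF that] by (simp add: ae_le_def)
    then show "AE s in lebesgue. s \<in> I \<longrightarrow> ?P x i s \<le> ?P y i s"
      by eventually_elim auto
  qed
  have "\<exists>x\<in>?S. \<forall>y\<in>?S. ae_le I x y \<longrightarrow> ae_le I y x"
  proof (rule ae_maximal_exists[OF measurable])
    have "(\<lambda>_ _. 0) \<in> ?S" using R_nonneg by (auto simp: L1_ball_def L1_fun_def ae_le_def set_integrable_def set_lebesgue_integral_def)
    then show "?S \<noteq> {}" by blast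
    fix c :: "nat \<Rightarrow> 'm \<Rightarrow> real \<Rightarrow> real" and u
    assume c: "\<And>n. c n \<in> ?S" and u: "u \<in> L1_ball I R" and ub: "\<And>n. ae_le I (c n) u"
      and least: "\<And>v. (\<And>n. ae_le I (c n) v) \<Longrightarrow> ae_le I u v"
    have "ae_le I (c n) (?P u)" for n
      using c[of n] P_mono[OF _ u ub] by (blast intro: ae_le_trans)
    then show "u \<in> ?S" using u least by blast
  qed blast
  then obtain x where x: "x \<in> ?S" and max: "\<And>y. y \<in> ?S \<Longrightarrow> ae_le I x y \<Longrightarrow> ae_le I y x" by blast
  have "?P x \<in> ?S" using x P_ball P_mono by blast
  then have "ae_le I (?P x) x" using max x by blast
  moreover have "ae_le I (T x) (?P x)" by (simp add: ae_le_def)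
  ultimately show ?thesis using x ae_le_trans by blast
qed

lemma lower_point_exists: "\<exists>x\<in>L1_ball I R. ae_le I x (T x)"
proof -
  interpret d: increasing_on_ball I R "\<lambda>x i s. - T (\<lambda>j r. - x j r) i s" by (rule dual)
  obtain x where x: "x \<in> L1_ball I R" "ae_le I (\<lambda>i s. - T (\<lambda>j r. - x j r) i s) x"
    using d.upper_point_exists by blast
  from x(2) have "ae_le I (\<lambda>i s. - x i s) (T (\<lambda>j r. - x j r))"
    by (simp add: ae_le_def minus_le_iff)
  with L1_ball_uminus[OF x(1)] show ?thesis by blast
qed

text \<open>
  Maximality is obtained among all points with \<open>z \<le> T z\<close>. If \<open>x\<close> is maximal there, then
  \<open>T x \<ge> x\<close> belongs to this set too, which makes \<open>x\<close> a fixed point.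
\<close>

lemma maximal_fixed_point:
  "\<exists>x\<in>L1_ball I R. ae_le I x (T x) \<and> ae_le I (T x) x \<and>
     (\<forall>z\<in>L1_ball I R. ae_le I z (T z) \<longrightarrow> ae_le I x z \<longrightarrow> ae_le I z x)"
proof -
  let ?S = "{x \<in> L1_ball I R. ae_le I x (T x)}"
  have "\<exists>x\<in>?S. \<forall>y\<in>?S. ae_le I x y \<longrightarrow> ae_le I y x"
  proof (rule ae_maximal_exists[OF measurable])
    show "?S \<noteq> {}" using lower_point_exists by blast
    fix c :: "nat \<Rightarrow> 'm \<Rightarrow> real \<Rightarrow> real" and u
    assume c: "\<And>n. c n \<in> ?S" and u: "u \<in> L1_ball I R" and ub: "\<And>n. ae_le I (c n) u"
      and least: "\<And>v. (\<And>n. ae_le I (c n) v) \<Longrightarrow> ae_le I u v"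
    have "ae_le I (c n) (T u)" for n
      using c[of n] increasing[OF _ u ub] by (blast intro: ae_le_trans)
    then show "u \<in> ?S" using u least by blast
  qed blast
  then obtain x where x: "x \<in> ?S" and max: "\<And>y. y \<in> ?S \<Longrightarrow> ae_le I x y \<Longrightarrow> ae_le I y x" by blast
  have "T x \<in> ?S" using x maps increasing by blast
  then have "ae_le I (T x) x" using max x by blast
  with x max show ?thesis by blast
qed

lemma minimal_fixed_point:
  "\<exists>x\<in>L1_ball I R. ae_le I x (T x) \<and> ae_le I (T x) x \<and>
     (\<forall>z\<in>L1_ball I R. ae_le I (T z) z \<longrightarrow> ae_le I z x \<longrightarrow> ae_le I x z)"
proof -
  interpret d: increasing_on_ball I R "\<lambda>x i s. - T (\<lambda>j r. - x j r) i s" by (rule dual)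
  let ?n = "\<lambda>x i s. - x i s"
  have neg: "ae_le I (?n x) (?n y) = ae_le I y x" for x y :: "'m \<Rightarrow> real \<Rightarrow> real"
    by (simp add: ae_le_def)
  obtain x where x: "x \<in> L1_ball I R" "ae_le I x (?n (T (?n x)))" "ae_le I (?n (T (?n x))) x"
    and max: "\<And>z. z \<in> L1_ball I R \<Longrightarrow> ae_le I z (?n (T (?n z))) \<Longrightarrow> ae_le I x z \<Longrightarrow> ae_le I z x"
    using d.maximal_fixed_point by blast
  show ?thesis
  proof (intro bexI[of _ "?n x"] conjI ballI impI)
    show "ae_le I (?n x) (T (?n x))" "ae_le I (T (?n x)) (?n x)"
      using x(2,3) neg[of x "?n (T (?n x))"] neg[of "?n (T (?n x))" x] by simp_all
    fix z assume "z \<in> L1_ball I R" "ae_le I (T z) z" "ae_le I z (?n x)"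
    then have "ae_le I (?n z) x"
      using max[of "?n z"] neg[of z "T z"] neg[of "?n x" z] by (simp add: L1_ball_uminus)
    then show "ae_le I (?n x) z" using neg[of x "?n z"] by simp
  qed (rule L1_ball_uminus[OF x(1)])
qed

end


section \<open>From tuples of functions to tuples of classes\<close>

lemma L1_class_in_L1_pow: "x \<in> L1_fun I \<Longrightarrow> (\<lambda>j. L1_class I (x j)) \<in> L1_pow I"
  by (auto simp: L1_fun_def L1_pow_def L1_def L1_class_def intro: quotientI)

lemma L1_pow_le_classI:
  assumes le: "ae_le I x y"
  shows "L1_pow_le I (\<lambda>j. L1_class I (x j)) (\<lambda>j. L1_class I (y j))"
  unfolding L1_pow_le_def L1_le_def
proof (intro allI ballI)
  fix i u v assume "u \<in> L1_class I (x i)" "v \<in> L1_class I (y i)"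
  then have "AE s in lebesgue. s \<in> I \<longrightarrow> x i s = u s" "AE s in lebesgue. s \<in> I \<longrightarrow> y i s = v s"
    by (auto simp: L1_class_def L1_rel_def)
  moreover have "AE s in lebesgue. s \<in> I \<longrightarrow> x i s \<le> y i s"
    using le by (simp add: ae_le_def)
  ultimately show "AE s in lebesgue. s \<in> I \<longrightarrow> u s \<le> v s"
    by eventually_elim auto
qed

lemma L1_class_eqI:
  assumes "x \<in> L1_fun I" "y \<in> L1_fun I" "ae_le I x y" "ae_le I y x"
  shows "(\<lambda>j. L1_class I (x j)) = (\<lambda>j. L1_class I (y j))"
proof
  fix j
  have "AE s in lebesgue. s \<in> I \<longrightarrow> x j s \<le> y j s" "AE s in lebesgue. s \<in> I \<longrightarrow> y j s \<le> x j s"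
    using assms(3,4) by (auto simp: ae_le_def)
  then have "AE s in lebesgue. s \<in> I \<longrightarrow> x j s = y j s"
    by eventually_elim auto
  then have "(x j, y j) \<in> L1_rel I"
    using assms(1,2) by (simp add: L1_rel_def L1_fun_def)
  then show "L1_class I (x j) = L1_class I (y j)"
    unfolding L1_class_def by (rule equiv_class_eq[OF equiv_L1_rel])
qed

lemma L1_pow_norm_class:
  assumes "x \<in> L1_fun I"
  shows "L1_pow_norm I (\<lambda>j. L1_class I (x j)) = Max (range (\<lambda>j. LINT s:I|lebesgue. \<bar>x j s\<bar>))"
  using assms by (simp add: L1_pow_norm_def L1_fun_def L1_norm_class)

lemma L1_pow_norm_class_nonneg:
  assumes "x \<in> L1_fun I"
  shows "L1_pow_norm I (\<lambda>j. L1_class I (x j)) \<ge> 0"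
  unfolding L1_pow_norm_class[OF assms]
  by (rule order_trans[OF _ Max_ge[OF _ rangeI]]) (auto simp: set_lebesgue_integral_def)

lemma L1_ball_iff:
  "x \<in> L1_ball I R \<longleftrightarrow> x \<in> L1_fun I \<and> L1_pow_norm I (\<lambda>j. L1_class I (x j)) \<le> R"
  by (auto simp: L1_ball_def L1_pow_norm_class)

lemma Llc_tuple_in_L1_fun: "(\<And>i. y i \<in> Llc a I) \<Longrightarrow> y \<in> L1_fun I"
  by (simp add: L1_fun_def Llc_def)

section \<open>Extremal solutions of the Cauchy system\<close>

lemma left_closed_intervalI:
  assumes "(\<exists>b>a. I = {a..b} \<or> I = {a..<b}) \<or> I = {a..}"
  shows "left_closed_interval a I"
  using assms by unfold_locales auto

theorem theorem7p2:
  fixes a R :: real and I :: "real set" and Q :: "real \<Rightarrow> real"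
    and f :: "'m::finite \<Rightarrow> ('m \<Rightarrow> (real \<Rightarrow> real) set) \<Rightarrow> dist"
  assumes interval: "(\<exists>b>a. I = {a..b} \<or> I = {a..<b}) \<or> I = {a..}"
    and maps: "\<And>i. f i \<in> L1_pow I \<rightarrow> AL a I"
    and increasing: "\<And>i x y. \<lbrakk>x \<in> L1_pow I; y \<in> L1_pow I; L1_pow_le I x y\<rbrakk> \<Longrightarrow> AL_le a I (f i x) (f i y)"
    and bound: "\<And>i x. x \<in> L1_pow I \<Longrightarrow>
       L1_norm I (L1_class I (primitive a I (f i x))) \<le> Q (L1_pow_norm I x)"
    and Q_maps: "Q \<in> {0..} \<rightarrow> {0..}"
    and Q_mono: "mono_on {0..} Q"
    and R_pos: "R > 0"
    and R_fixed: "R = Q R"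
    and R_max: "\<And>r. \<lbrakk>r \<ge> 0; r \<le> Q r\<rbrakk> \<Longrightarrow> r \<le> R"
  shows "(\<exists>y. minimal_in (Llc_pow_le I) (solutions a I f) y) \<and>
         (\<exists>y. maximal_in (Llc_pow_le I) (solutions a I f) y)"
proof -
  interpret left_closed_interval a I
    by (rule left_closed_intervalI[OF interval])
  define cls where "cls x = (\<lambda>j. L1_class I (x j))" for x :: "'m \<Rightarrow> real \<Rightarrow> real"
  define T where "T x i = primitive a I (f i (cls x))" for x i
  have cls_in: "cls x \<in> L1_pow I" if "x \<in> L1_fun I" for x
    unfolding cls_def using that by (rule L1_class_in_L1_pow)
  have T_Llc0: "T x i \<in> Llc0 a I"
    and T_deriv: "dist_deriv I (dist_of I (T x i)) = f i (cls x)" if "x \<in> L1_fun I" for x i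
    using AL_primitive[OF funcset_mem[OF maps cls_in[OF that]], of i] unfolding T_def by auto
  have T_fun: "T x \<in> L1_fun I" if "x \<in> L1_fun I" for x
    using T_Llc0[OF that] by (intro Llc_tuple_in_L1_fun) (auto simp: Llc0_def)
  have T_mono: "ae_le I (T x) (T y)" if "x \<in> L1_fun I" "y \<in> L1_fun I" "ae_le I x y" for x y
    using increasing[OF cls_in[OF that(1)] cls_in[OF that(2)]] L1_pow_le_classI[OF that(3)]
    by (auto simp: ae_le_def AL_le_def T_def cls_def)
  have T_norm: "L1_pow_norm I (cls (T x)) \<le> Q (L1_pow_norm I (cls x))" if "x \<in> L1_fun I" for x
    unfolding L1_pow_norm_def[of I "cls (T x)"]
    using bound[OF cls_in[OF that]] by (auto simp: cls_def T_def)
  have T_ball: "T x \<in> L1_ball I R" if "x \<in> L1_ball I R" for x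
  proof -
    have x: "x \<in> L1_fun I" "L1_pow_norm I (cls x) \<le> R" "0 \<le> L1_pow_norm I (cls x)"
      using that L1_pow_norm_class_nonneg by (auto simp: L1_ball_iff cls_def)
    have "L1_pow_norm I (cls (T x)) \<le> Q (L1_pow_norm I (cls x))" by (rule T_norm[OF x(1)])
    also have "\<dots> \<le> Q R" using x R_pos by (intro mono_onD[OF Q_mono]) auto
    finally show ?thesis using T_fun[OF x(1)] R_fixed by (simp add: L1_ball_iff cls_def)
  qed
  have ball_fun: "x \<in> L1_fun I" if "x \<in> L1_ball I R" for x :: "'m \<Rightarrow> real \<Rightarrow> real"
    using that by (simp add: L1_ball_iff)
  interpret increasing_on_ball I R T
    using measurable R_pos T_ball T_mono ball_fun by unfold_locales auto
  have T_cong: "T x = T y" if "x \<in> L1_fun I" "y \<in> L1_fun I" "ae_le I x y" "ae_le I y x" for x y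
    using L1_class_eqI[OF that] by (simp add: T_def[abs_def] cls_def)
  \<comment> \<open>Solutions are exact fixed points by uniqueness of primitives, and the hypothesis on numbers
     \<open>r\<close> with \<open>r \<le> Q r\<close>, applied to the norm of a solution, puts them into the ball.\<close>
  have solutionD: "z \<in> L1_ball I R" "T z = z" if z: "z \<in> solutions a I f" for z
  proof -
    have zf: "z \<in> L1_fun I"
      using z by (intro Llc_tuple_in_L1_fun) (auto simp: solutions_def)
    show Tz: "T z = z"
    proof
      fix i
      show "T z i = z i"
        unfolding T_def using z by (intro primitive_eqI) (auto simp: solutions_def Llc0_def cls_def)
    qed
    have "L1_pow_norm I (cls z) \<le> Q (L1_pow_norm I (cls z))"
      using T_norm[OF zf] Tz by simp
    then have "L1_pow_norm I (cls z) \<le> R"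
      using L1_pow_norm_class_nonneg[OF zf] by (intro R_max) (simp_all add: cls_def)
    then show "z \<in> L1_ball I R" using zf by (simp add: L1_ball_iff cls_def)
  qed
  \<comment> \<open>A fixed point up to null sets need not be left continuous; its image under \<open>T\<close> is the
     representative that is.\<close>
  have solutionI: "T x \<in> solutions a I f"
    if x: "x \<in> L1_ball I R" "ae_le I x (T x)" "ae_le I (T x) x" for x
  proof -
    have "cls (T x) = cls x"
      unfolding cls_def using x ball_fun T_ball by (intro L1_class_eqI) auto
    then show ?thesis
      using T_Llc0[OF ball_fun[OF x(1)]] T_deriv[OF ball_fun[OF x(1)]]
      by (auto simp: solutions_def Llc0_def cls_def)
  qed
  have le_ae: "ae_le I y z" if "Llc_pow_le I y z" for y z :: "'m \<Rightarrow> real \<Rightarrow> real"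
    using that by (auto simp: Llc_pow_le_def ae_le_def)
  obtain x where x: "x \<in> L1_ball I R" "ae_le I x (T x)" "ae_le I (T x) x"
    and x_min: "\<And>z. z \<in> L1_ball I R \<Longrightarrow> ae_le I (T z) z \<Longrightarrow> ae_le I z x \<Longrightarrow> ae_le I x z"
    using minimal_fixed_point by blast
  have "minimal_in (Llc_pow_le I) (solutions a I f) (T x)"
    unfolding minimal_in_def
  proof (intro conjI ballI impI solutionI x)
    fix z assume z: "z \<in> solutions a I f" and le: "Llc_pow_le I z (T x)"
    note zD = solutionD[OF z]
    have zx: "ae_le I z x" using le_ae[OF le] x(3) by (rule ae_le_trans)
    have "ae_le I x z" using x_min[OF zD(1) _ zx] zD(2) by (simp add: ae_le_refl)
    then show "z = T x" using T_cong[of z x] zx zD ball_fun x(1) by simp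
  qed
  moreover
  obtain w where w: "w \<in> L1_ball I R" "ae_le I w (T w)" "ae_le I (T w) w"
    and w_max: "\<And>z. z \<in> L1_ball I R \<Longrightarrow> ae_le I z (T z) \<Longrightarrow> ae_le I w z \<Longrightarrow> ae_le I z w"
    using maximal_fixed_point by blast
  have "maximal_in (Llc_pow_le I) (solutions a I f) (T w)"
    unfolding maximal_in_def
  proof (intro conjI ballI impI solutionI w)
    fix z assume z: "z \<in> solutions a I f" and le: "Llc_pow_le I (T w) z"
    note zD = solutionD[OF z]
    have wz: "ae_le I w z" using w(2) le_ae[OF le] by (rule ae_le_trans)
    have "ae_le I z w" using w_max[OF zD(1) _ wz] zD(2) by (simp add: ae_le_refl)
    then show "z = T w" using T_cong[of z w] wz zD ball_fun w(1) by simp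
  qed
  ultimately show ?thesis by blast
qed

end
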